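(* Let $G$ be a nonlinear polynomial with an attracting fixed point at the origin, $G(0)=0$, $G'(0)=a$, $0<|a|<1$. Let $\mathcal K_p$ be the connected component containing the origin of the Fatou set of $G$. Then $\mathcal K_p$ is an open, bounded and simply connected set, the domain of analyticity of $Q$ is $\mathcal K_p$ (that is, $Q$ extends to a single-valued analytic function on $\mathcal K_p$), and $\partial\mathcal K_p$ is a singularity barrier of $Q$.
   Context: The Fatou set of a non-constant rational map $G$ is the maximal open subset of the Riemann sphere $\mathbb C_\infty$ on which the iterates $\{G^{\circ n}\}$ are equicontinuous (in the chordal metric). Let $\varphi$ be the unique map analytic at $0$ with $\varphi(0)=0$, $\varphi'(0)=1$, $\varphi(az)=G(\varphi(z))$ near $0$ (Poincaré's theorem). $Q:=\varphi^{-1}$ is the local inverse, analytic near $0$; it satisfies $Q(z)=a^{-1}Q(G(z))$, and $C(n,x_n)=Q(x_n)a^{-n}$ is a conserved quantity of $x_{n+1}=G(x_n)$. $\partial\mathcal K_p$ is a singularity barrier of $Q$ if for no point $z_0\in\partial\mathcal K_p$ and no disk $D$ centered at $z_0$ is there an analytic function on $\mathcal K_p\cup D$ that coincides with $Q$ on $\mathcal K_p$. *)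

theory Defs
  imports "HOL-Complex_Analysis.Complex_Analysis" "HOL-Computational_Algebra.Polynomial"
begin

datatype riemann_sphere = Pt complex | Infty

text \<open>Stereographic projection onto the unit sphere of \<^typ>\<open>complex \<times> real\<close>. The chordal metric is
  the Euclidean distance of the images; its usual closed form is derived below.\<close>

fun stereo :: "riemann_sphere \<Rightarrow> complex \<times> real" where
  "stereo (Pt z) = (2 * z / of_real (1 + (cmod z)\<^sup>2), ((cmod z)\<^sup>2 - 1) / (1 + (cmod z)\<^sup>2))"
| "stereo Infty = (0, 1)"

lemma one_plus_cmod_sq_pos: "1 + (cmod z)\<^sup>2 > 0"
  by (simp add: add_pos_nonneg)

lemma stereo_inject: "stereo x = stereo y \<longleftrightarrow> x = y"
proof
  have height: "((cmod z)\<^sup>2 - 1) / (1 + (cmod z)\<^sup>2) \<noteq> 1" for z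
    using one_plus_cmod_sq_pos[of z] by (simp add: divide_simps)
  have Pt: "z = w" if "stereo (Pt z) = stereo (Pt w)" for z w
  proof -
    have "((cmod z)\<^sup>2 - 1) / (1 + (cmod z)\<^sup>2) = ((cmod w)\<^sup>2 - 1) / (1 + (cmod w)\<^sup>2)"
      using that by simp
    then have "((cmod z)\<^sup>2 - 1) * (1 + (cmod w)\<^sup>2) = ((cmod w)\<^sup>2 - 1) * (1 + (cmod z)\<^sup>2)"
      using one_plus_cmod_sq_pos[of z] one_plus_cmod_sq_pos[of w] by (simp add: frac_eq_eq)
    then have sq: "(cmod z)\<^sup>2 = (cmod w)\<^sup>2"
      by (simp add: algebra_simps)
    have "complex_of_real (1 + (cmod w)\<^sup>2) \<noteq> 0"
      using one_plus_cmod_sq_pos[of w] by (simp only: of_real_eq_0_iff)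
    moreover have "2 * z / of_real (1 + (cmod w)\<^sup>2) = 2 * w / of_real (1 + (cmod w)\<^sup>2)"
      using that sq by simp
    ultimately show ?thesis
      by (simp only: divide_cancel_right mult_cancel_left) simp
  qed
  assume "stereo x = stereo y"
  then show "x = y"
  proof (cases x; cases y)
    fix z w assume "x = Pt z" "y = Pt w"
    then show ?thesis using \<open>stereo x = stereo y\<close> Pt by blast
  next
    fix z assume "x = Pt z" "y = Infty"
    then show ?thesis using \<open>stereo x = stereo y\<close> height[of z] by simp
  next
    fix w assume "x = Infty" "y = Pt w"
    then show ?thesis using \<open>stereo x = stereo y\<close> height[of w] by simp
  qed simp
qed simp

instantiation riemann_sphere :: metric_space
begin

definition dist_riemann_sphere :: "riemann_sphere \<Rightarrow> riemann_sphere \<Rightarrow> real" where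
  "dist x y = dist (stereo x) (stereo y)"

definition uniformity_riemann_sphere :: "(riemann_sphere \<times> riemann_sphere) filter" where
  "(uniformity :: (riemann_sphere \<times> riemann_sphere) filter) = (INF e\<in>{0<..}. principal {(x, y). dist x y < e})"

definition open_riemann_sphere :: "riemann_sphere set \<Rightarrow> bool" where
  "open (U :: riemann_sphere set) \<longleftrightarrow> (\<forall>x\<in>U. eventually (\<lambda>(x', y). x' = x \<longrightarrow> y \<in> U) uniformity)"

instance
proof
  fix x y z :: riemann_sphere
  show "dist x y = 0 \<longleftrightarrow> x = y"
    by (simp add: dist_riemann_sphere_def stereo_inject)
  show "dist x y \<le> dist x z + dist y z"
    unfolding dist_riemann_sphere_def by (rule dist_triangle2)
qed (simp_all add: uniformity_riemann_sphere_def open_riemann_sphere_def)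

end

lemma chordal_dist_Pt_Infty: "dist (Pt z) Infty = 2 / sqrt (1 + (cmod z)\<^sup>2)"
proof -
  define N where "N = 1 + (cmod z)\<^sup>2"
  have N: "N > 0" "(cmod z)\<^sup>2 = N - 1"
    using one_plus_cmod_sq_pos[of z] by (auto simp: N_def)
  have "(cmod (2 * z / of_real N))\<^sup>2 + ((N - 2) / N - 1)\<^sup>2 = (2 / sqrt N)\<^sup>2"
    using N(1) by (simp add: norm_divide norm_mult power_divide power_mult_distrib N(2))
      (simp add: field_simps power2_eq_square)
  moreover have "dist (Pt z) Infty = sqrt ((cmod (2 * z / of_real N))\<^sup>2 + ((N - 2) / N - 1)\<^sup>2)"
    by (simp add: dist_riemann_sphere_def dist_norm norm_Pair N_def)
  ultimately show ?thesis
    using N(1) by (simp add: N_def[symmetric])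
qed

lemma chordal_dist_Pt_Pt:
  "dist (Pt z) (Pt w) = 2 * cmod (z - w) / (sqrt (1 + (cmod z)\<^sup>2) * sqrt (1 + (cmod w)\<^sup>2))"
proof -
  define M N where "M = 1 + (cmod z)\<^sup>2" and "N = 1 + (cmod w)\<^sup>2"
  have M: "M > 0" and N: "N > 0"
    using one_plus_cmod_sq_pos by (auto simp: M_def N_def)
  have Mz: "M = 1 + (Re z)\<^sup>2 + (Im z)\<^sup>2" and Nw: "N = 1 + (Re w)\<^sup>2 + (Im w)\<^sup>2"
    by (auto simp: M_def N_def cmod_power2)
  have "(cmod (2 * z / of_real M - 2 * w / of_real N))\<^sup>2 + ((M - 2) / M - (N - 2) / N)\<^sup>2
      = ((2 * Re z / M - 2 * Re w / N)\<^sup>2 + (2 * Im z / M - 2 * Im w / N)\<^sup>2) + (2 / N - 2 / M)\<^sup>2"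
    using M N by (simp add: cmod_power2 diff_divide_distrib)
  also have "\<dots> = ((2 * Re z * N - 2 * Re w * M)\<^sup>2 + (2 * Im z * N - 2 * Im w * M)\<^sup>2
      + (2 * M - 2 * N)\<^sup>2) / (M * N)\<^sup>2"
    using M N by (simp add: field_simps power2_eq_square)
  also have "(2 * Re z * N - 2 * Re w * M)\<^sup>2 + (2 * Im z * N - 2 * Im w * M)\<^sup>2 + (2 * M - 2 * N)\<^sup>2
      = 4 * ((Re z - Re w)\<^sup>2 + (Im z - Im w)\<^sup>2) * (M * N)"
    unfolding Mz Nw by (simp add: algebra_simps power2_eq_square)
  also have "\<dots> / (M * N)\<^sup>2 = (2 * cmod (z - w) / (sqrt M * sqrt N))\<^sup>2"
  proof -
    have "(2 * cmod (z - w) / (sqrt M * sqrt N))\<^sup>2 = 4 * (cmod (z - w))\<^sup>2 / (M * N)"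
      using M N by (simp add: power_divide power_mult_distrib)
    also have "(cmod (z - w))\<^sup>2 = (Re z - Re w)\<^sup>2 + (Im z - Im w)\<^sup>2"
      by (simp add: cmod_power2)
    finally show ?thesis
      using M N by (simp add: power2_eq_square)
  qed
  finally have "(cmod (2 * z / of_real M - 2 * w / of_real N))\<^sup>2 + ((M - 2) / M - (N - 2) / N)\<^sup>2
      = (2 * cmod (z - w) / (sqrt M * sqrt N))\<^sup>2" .
  moreover have "dist (Pt z) (Pt w)
      = sqrt ((cmod (2 * z / of_real M - 2 * w / of_real N))\<^sup>2 + ((M - 2) / M - (N - 2) / N)\<^sup>2)"
    by (simp add: dist_riemann_sphere_def dist_norm norm_Pair M_def N_def)
  ultimately show ?thesis
    using M N by (simp add: M_def[symmetric] N_def[symmetric])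
qed

definition equicontinuous_on :: "'a::metric_space set \<Rightarrow> ('a \<Rightarrow> 'b::metric_space) set \<Rightarrow> bool" where
  "equicontinuous_on U \<F> \<longleftrightarrow>
     (\<forall>x\<in>U. \<forall>e>0. \<exists>d>0. \<forall>f\<in>\<F>. \<forall>y\<in>U. dist y x < d \<longrightarrow> dist (f y) (f x) < e)"

definition fatou_set :: "(riemann_sphere \<Rightarrow> riemann_sphere) \<Rightarrow> riemann_sphere set" where
  "fatou_set R = \<Union>{U. open U \<and> equicontinuous_on U (range (\<lambda>n. R ^^ n))}"

lemma fatou_set_maximal:
  shows "open (fatou_set R)"
    and "equicontinuous_on (fatou_set R) (range (\<lambda>n. R ^^ n))"
    and "open U \<Longrightarrow> equicontinuous_on U (range (\<lambda>n. R ^^ n)) \<Longrightarrow> U \<subseteq> fatou_set R"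
proof -
  show "open (fatou_set R)"
    by (auto simp: fatou_set_def)
  show "equicontinuous_on (fatou_set R) (range (\<lambda>n. R ^^ n))"
    unfolding equicontinuous_on_def
  proof (intro ballI allI impI)
    fix x and e :: real
    assume "x \<in> fatou_set R" "e > 0"
    then obtain U where U: "open U" "equicontinuous_on U (range (\<lambda>n. R ^^ n))" "x \<in> U"
      by (auto simp: fatou_set_def)
    obtain d1 where d1: "d1 > 0" "\<And>y. dist y x < d1 \<Longrightarrow> y \<in> U"
      using U(1,3) by (auto simp: open_dist)
    obtain d2 where d2: "d2 > 0"
      "\<forall>f\<in>range (\<lambda>n. R ^^ n). \<forall>y\<in>U. dist y x < d2 \<longrightarrow> dist (f y) (f x) < e"
      using U(2,3) \<open>e > 0\<close> unfolding equicontinuous_on_def by blast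
    show "\<exists>d>0. \<forall>f\<in>range (\<lambda>n. R ^^ n). \<forall>y\<in>fatou_set R. dist y x < d \<longrightarrow> dist (f y) (f x) < e"
      using d1 d2 by (intro exI[of _ "min d1 d2"]) auto
  qed
  show "open U \<Longrightarrow> equicontinuous_on U (range (\<lambda>n. R ^^ n)) \<Longrightarrow> U \<subseteq> fatou_set R"
    by (auto simp: fatou_set_def)
qed

text \<open>The continuous extension of a polynomial to the sphere; it fixes \<^const>\<open>Infty\<close>
  unless the polynomial is constant.\<close>

fun sphere_poly :: "complex poly \<Rightarrow> riemann_sphere \<Rightarrow> riemann_sphere" where
  "sphere_poly G (Pt z) = Pt (poly G z)"
| "sphere_poly G Infty = (if degree G = 0 then Pt (coeff G 0) else Infty)"

definition origin_fatou_component :: "complex poly \<Rightarrow> riemann_sphere set" where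
  "origin_fatou_component G = connected_component_set (fatou_set (sphere_poly G)) (Pt 0)"

definition K_p :: "complex poly \<Rightarrow> complex set" where
  "K_p G = {z. Pt z \<in> origin_fatou_component G}"

definition poincare_map :: "(complex \<Rightarrow> complex) \<Rightarrow> complex \<Rightarrow> (complex \<Rightarrow> complex) \<Rightarrow> bool" where
  "poincare_map G a \<phi> \<longleftrightarrow> \<phi> analytic_on {0} \<and> \<phi> 0 = 0 \<and> deriv \<phi> 0 = 1 \<and>
     (\<forall>\<^sub>F z in nhds 0. \<phi> (a * z) = G (\<phi> z))"

text \<open>Only the germ at 0 of the local inverse is determined; its values elsewhere are arbitrary.\<close>

definition analytic_local_inverse :: "(complex \<Rightarrow> complex) \<Rightarrow> (complex \<Rightarrow> complex) \<Rightarrow> bool" where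
  "analytic_local_inverse \<phi> Q \<longleftrightarrow> Q analytic_on {0} \<and> Q 0 = 0 \<and>
     (\<forall>\<^sub>F z in nhds 0. Q (\<phi> z) = z) \<and> (\<forall>\<^sub>F w in nhds 0. \<phi> (Q w) = w)"

definition singularity_barrier :: "complex set \<Rightarrow> (complex \<Rightarrow> complex) \<Rightarrow> bool" where
  "singularity_barrier K Q \<longleftrightarrow>
     (\<forall>z0\<in>frontier K. \<forall>r>0. \<not> (\<exists>h. h analytic_on (K \<union> ball z0 r) \<and> (\<forall>z\<in>K. h z = Q z)))"

end

theory Submission
  imports Defs "HOL-Computational_Algebra.Fundamental_Theorem_Algebra"
begin

text \<open>The component lies in the basin of 0 and is filled by the maximum principle. The functional
  equation \<open>Q (G z) = a * Q z\<close> extends \<open>Q\<close> to the basin by \<open>Q (G\<^sup>n z) / a\<^sup>n\<close>. If \<open>Q\<close> were bounded on the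
  part of the component in some disk around a boundary point, then \<open>Q \<circ> G\<^sup>n\<close> would be uniformly
  small there for large \<open>n\<close>; an orbit entering the linearization disk would be deep inside it, so
  the set of points having entered by time \<open>n\<close> would be open and closed in the disk, which would
  thus be contained in the component. So \<open>Q\<close> is unbounded near every boundary point.\<close>

section \<open>The plane as an open subset of the sphere\<close>

lemma dist_Pt_le: "dist (Pt z) (Pt w) \<le> 2 * cmod (z - w)"
proof -
  have "1 * 1 \<le> sqrt (1 + (cmod z)\<^sup>2) * sqrt (1 + (cmod w)\<^sup>2)"
    by (intro mult_mono) auto
  then have "2 * cmod (z - w) / (sqrt (1 + (cmod z)\<^sup>2) * sqrt (1 + (cmod w)\<^sup>2)) \<le> 2 * cmod (z - w) / 1"
    by (intro divide_left_mono) auto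
  then show ?thesis
    by (simp add: chordal_dist_Pt_Pt)
qed

lemma continuous_on_Pt: "continuous_on S Pt"
  unfolding continuous_on_iff
proof (intro ballI allI impI)
  fix x and e :: real assume "e > 0"
  moreover have "dist (Pt y) (Pt x) < e" if "dist y x < e/2" for y
    using dist_Pt_le[of y x] that by (simp add: dist_norm)
  ultimately show "\<exists>d>0. \<forall>x'\<in>S. dist x' x < d \<longrightarrow> dist (Pt x') (Pt x) < e"
    by (intro exI[of _ "e/2"]) simp
qed

text \<open>Inverse stereographic projection from the pole \<open>Infty\<close>, where it takes the
  default value 0 / 0 = 0. The closed formula makes continuity on \<open>range Pt\<close>
  immediate.\<close>

definition unPt :: "riemann_sphere \<Rightarrow> complex" where
  "unPt x = fst (stereo x) / of_real (1 - snd (stereo x))"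

lemma one_minus_height: "1 - snd (stereo (Pt z)) = 2 / (1 + (cmod z)\<^sup>2)"
  using one_plus_cmod_sq_pos[of z] by (simp add: field_simps)

lemma unPt_Pt [simp]: "unPt (Pt z) = z"
proof -
  have "1 + (cmod z)\<^sup>2 \<noteq> 0"
    using one_plus_cmod_sq_pos[of z] by linarith
  then have "complex_of_real (1 + (cmod z)\<^sup>2) \<noteq> 0"
    by (simp only: of_real_eq_0_iff not_False_eq_True)
  then show ?thesis
    unfolding unPt_def one_minus_height by (simp del: of_real_add)
qed

lemma range_Pt: "range Pt = - {Infty}"
proof (intro equalityI subsetI)
  fix x :: riemann_sphere assume "x \<in> - {Infty}"
  then show "x \<in> range Pt"
    by (cases x) auto
qed auto

lemma continuous_on_stereo: "continuous_on S stereo"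
  unfolding continuous_on_iff dist_riemann_sphere_def by blast

lemma continuous_on_unPt: "continuous_on (range Pt) unPt"
  unfolding unPt_def
proof (intro continuous_intros continuous_on_fst continuous_on_snd continuous_on_stereo ballI)
  fix x assume "x \<in> range Pt"
  then obtain z where "x = Pt z"
    by blast
  have "1 - snd (stereo (Pt z)) \<noteq> 0"
    unfolding one_minus_height using one_plus_cmod_sq_pos[of z] by simp
  then show "complex_of_real (1 - snd (stereo x)) \<noteq> 0"
    using \<open>x = Pt z\<close> by (simp only: of_real_eq_0_iff not_False_eq_True)
qed

lemma open_Pt_image:
  assumes "open U" shows "open (Pt ` U)"
proof -
  have "open (range Pt)"
    unfolding range_Pt by (simp add: open_Compl)
  moreover have "Pt ` U = unPt -` U \<inter> range Pt"
    by force
  ultimately show ?thesis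
    using continuous_on_unPt assms by (simp add: continuous_on_open_vimage)
qed

section \<open>Growth estimates and equicontinuity for polynomial iterates\<close>

lemma sphere_poly_pow_Pt: "(sphere_poly G ^^ n) (Pt z) = Pt ((poly G ^^ n) z)"
  by (induction n) auto

lemma continuous_on_poly_pow: "continuous_on S ((poly G ^^ n) :: complex \<Rightarrow> complex)"
  by (induction n) (auto intro!: continuous_intros)

lemma holomorphic_on_poly_pow: "((poly G ^^ n) :: complex \<Rightarrow> complex) holomorphic_on S"
  by (induction n) (auto intro!: holomorphic_intros)

text \<open>The difference quotient tends to \<open>D\<close>, of modulus strictly below
  \<open>c\<close>. This serves both the contraction of \<open>G\<close> and the growth of
  \<open>\<phi>\<close>.\<close>

lemma eventually_norm_le_of_deriv:
  fixes f :: "complex \<Rightarrow> complex"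
  assumes "(f has_field_derivative D) (at 0)" "f 0 = 0" "cmod D < c"
  shows "\<forall>\<^sub>F z in nhds 0. cmod (f z) \<le> c * cmod z"
proof -
  have "((\<lambda>z. f z / z) \<longlongrightarrow> D) (at 0)"
    using assms(1,2) by (simp add: has_field_derivative_iff)
  then have "((\<lambda>z. cmod (f z / z)) \<longlongrightarrow> cmod D) (at 0)"
    by (rule tendsto_norm)
  then have "\<forall>\<^sub>F z in at 0. cmod (f z / z) < c"
    using assms(3) by (rule order_tendstoD)
  then have "\<forall>\<^sub>F z in at 0. cmod (f z) \<le> c * cmod z"
    by eventually_elim (auto simp: norm_divide divide_less_eq assms(2) split: if_splits)
  then show ?thesis
    using assms(2) by (auto simp: eventually_nhds_conv_at)
qed

text \<open>Factor G(z) = z p(z) with p nonconstant; where |p| \<ge> 1 the modulus cannot decrease.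
  So an orbit that leaves the disk never returns, which is enough to rule out convergence to
  0.\<close>

lemma poly_escape_radius:
  fixes G :: "complex poly"
  assumes "degree G \<ge> 2" "poly G 0 = 0"
  obtains R where "R > 0" "\<And>z. R < cmod z \<Longrightarrow> R < cmod (poly G z)"
proof -
  obtain p where G: "G = pCons 0 p"
    using assms(2) by (cases G) auto
  obtain c q where p: "p = pCons c q"
    by (cases p)
  have "q \<noteq> 0"
    using assms(1) unfolding G p by (auto split: if_splits)
  then obtain r where r: "\<And>z. r \<le> cmod z \<Longrightarrow> 1 \<le> cmod (poly p z)"
    using poly_infinity[of q 1 c] unfolding p by blast
  show ?thesis
  proof
    \<comment> \<open>The 1 only ensures a positive radius.\<close>
    fix z assume z: "max r 1 < cmod z"
    then have "1 \<le> cmod (poly p z)"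
      using r by simp
    then have "cmod z * 1 \<le> cmod z * cmod (poly p z)"
      by (rule mult_left_mono) simp
    then show "max r 1 < cmod (poly G z)"
      using z by (simp add: G norm_mult)
  qed simp
qed

text \<open>Cauchy's estimate on disks of radius \<open>d/2\<close>. The constant depends only on
  \<open>R\<close> and \<open>d\<close>, so it is the same for all iterates at once.\<close>

lemma bounded_holomorphic_lipschitz:
  assumes "f holomorphic_on ball w (2 * d)" "d > 0" "\<And>z. z \<in> ball w (2 * d) \<Longrightarrow> cmod (f z) \<le> R"
    and "x \<in> ball w d" "y \<in> ball w d"
  shows "cmod (f x - f y) \<le> 2 * R / d * cmod (x - y)"
proof (rule field_differentiable_bound[of "ball w d" f "deriv f"])
  fix z assume z: "z \<in> ball w d"
  have sub: "cball z (d/2) \<subseteq> ball w (2 * d)"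
  proof
    fix u assume "u \<in> cball z (d/2)"
    then have "dist w u \<le> dist w z + dist z u" "dist z u \<le> d/2"
      using dist_triangle by auto
    then show "u \<in> ball w (2 * d)"
      using z assms(2) by auto
  qed
  have z': "z \<in> ball w (2 * d)"
    using z assms(2) by auto
  then show "(f has_field_derivative deriv f z) (at z within ball w d)"
    using assms(1) holomorphic_derivI open_ball by blast
  have "cmod ((deriv ^^ 1) f z) \<le> fact 1 * R / (d/2) ^ 1"
  proof (rule Cauchy_inequality)
    show "f holomorphic_on ball z (d/2)"
      using assms(1) sub ball_subset_cball by (meson holomorphic_on_subset subset_trans)
    show "continuous_on (cball z (d/2)) f"
      using assms(1) sub holomorphic_on_imp_continuous_on holomorphic_on_subset by blast
    fix x assume "cmod (z - x) = d/2"
    then have "x \<in> cball z (d/2)"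
      by (simp add: dist_norm)
    then show "cmod (f x) \<le> R"
      using sub assms(3) by blast
  qed (use assms(2) in simp)
  then show "cmod (deriv f z) \<le> 2 * R / d"
    by (simp add: mult.commute)
qed (use assms(4,5) in auto)

text \<open>An elementary form of Montel's theorem: uniformly bounded iterates share a local
  Lipschitz constant, hence are equicontinuous.\<close>

lemma bounded_iterates_in_fatou_set:
  assumes "open U" "R > 0" and bound: "\<And>z n. z \<in> U \<Longrightarrow> cmod ((poly G ^^ n) z) \<le> R"
  shows "Pt ` U \<subseteq> fatou_set (sphere_poly G)"
proof (rule image_subsetI)
  fix w assume "w \<in> U"
  then obtain e where "e > 0" "ball w e \<subseteq> U"
    using assms(1) open_contains_ball by blast
  define d where "d = e/2"
  have d: "d > 0" "ball w (2 * d) \<subseteq> U"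
    using \<open>e > 0\<close> \<open>ball w e \<subseteq> U\<close> by (auto simp: d_def)
  have "equicontinuous_on (Pt ` ball w d) (range (\<lambda>n. sphere_poly G ^^ n))"
    unfolding equicontinuous_on_def
  proof (intro ballI allI impI)
    fix x and e :: real assume "x \<in> Pt ` ball w d" "e > 0"
    then obtain z where z: "x = Pt z" "z \<in> ball w d"
      by blast
    \<comment> \<open>The Lipschitz constant \<open>2 * R / d\<close> turns \<open>e'\<close> into
      \<open>e/2\<close>, and the passage to the chordal metric costs another factor 2.\<close>
    define e' where "e' = e * d / (4 * R)"
    have "e' > 0"
      using \<open>e > 0\<close> d assms(2) by (simp add: e'_def)
    then obtain t where t: "t > 0"
      "\<And>y. y \<in> range Pt \<Longrightarrow> dist y x < t \<Longrightarrow> dist (unPt y) (unPt x) < e'"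
      using continuous_on_unPt z unfolding continuous_on_iff by blast
    have "dist ((sphere_poly G ^^ n) y) ((sphere_poly G ^^ n) x) < e"
      if y: "y \<in> Pt ` ball w d" "dist y x < t" for n y
    proof -
      obtain u where u: "y = Pt u" "u \<in> ball w d"
        using y by blast
      have "cmod (u - z) < e'"
        using t(2)[of y] y u z by (auto simp: dist_norm)
      have "cmod ((poly G ^^ n) u - (poly G ^^ n) z) \<le> 2 * R / d * cmod (u - z)"
        using d bound z u
        by (intro bounded_holomorphic_lipschitz[of _ w] holomorphic_on_poly_pow) auto
      also have "\<dots> < 2 * R / d * e'"
        using \<open>cmod (u - z) < e'\<close> d assms(2) by (intro mult_strict_left_mono) auto
      also have "\<dots> = e / 2"
        using d assms(2) by (simp add: e'_def)
      finally show ?thesis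
        using dist_Pt_le[of "(poly G ^^ n) u" "(poly G ^^ n) z"]
        by (simp add: u z sphere_poly_pow_Pt)
    qed
    then show "\<exists>t>0. \<forall>f\<in>range (\<lambda>n. sphere_poly G ^^ n). \<forall>y\<in>Pt ` ball w d.
        dist y x < t \<longrightarrow> dist (f y) (f x) < e"
      using t(1) by blast
  qed
  then have "Pt ` ball w d \<subseteq> fatou_set (sphere_poly G)"
    by (intro fatou_set_maximal open_Pt_image) auto
  then show "Pt w \<in> fatou_set (sphere_poly G)"
    using d by auto
qed

section \<open>The basin of the origin and its place in the Fatou set\<close>

locale attracting_origin =
  fixes G :: "complex poly" and R r c :: real
  assumes nonconst: "degree G \<noteq> 0"
    and R_pos: "R > 0" and r_pos: "r > 0" and c: "0 \<le> c" "c < 1"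
    and escape: "\<And>z. R < cmod z \<Longrightarrow> R < cmod (poly G z)"
    and contract: "\<And>z. cmod z < r \<Longrightarrow> cmod (poly G z) \<le> c * cmod z"
begin

abbreviation it :: "nat \<Rightarrow> complex \<Rightarrow> complex" where "it n \<equiv> poly G ^^ n"

abbreviation F :: "riemann_sphere set" where "F \<equiv> fatou_set (sphere_poly G)"

text \<open>Since the disk of radius \<open>r\<close> is contracted to 0, entering it at some time
  is equivalent to convergence of the orbit to 0. In this form the basin is a union of open
  preimages.\<close>

definition basin :: "complex set" where
  "basin = {z. \<exists>n. cmod (it n z) < r}"

lemma it_contract:
  assumes "cmod (it n z) < r"
  shows "cmod (it (m + n) z) \<le> c ^ m * cmod (it n z)" "cmod (it (m + n) z) < r"
proof -
  have "cmod (it (m + n) z) \<le> c ^ m * cmod (it n z) \<and> cmod (it (m + n) z) < r"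
  proof (induction m)
    case (Suc m)
    then have "cmod (it (Suc m + n) z) \<le> c * cmod (it (m + n) z)"
      using contract by simp
    moreover have "c * cmod (it (m + n) z) \<le> c * (c ^ m * cmod (it n z))"
      using Suc c by (intro mult_left_mono) auto
    \<comment> \<open>The previous bound gives the geometric decay; this one keeps the orbit in the
      disk, where \<open>contract\<close> applies again.\<close>
    moreover have "c * cmod (it (m + n) z) \<le> 1 * cmod (it (m + n) z)"
      using c by (intro mult_right_mono) auto
    ultimately show ?case
      using Suc by (auto simp: mult.assoc)
  qed (use assms in auto)
  then show "cmod (it (m + n) z) \<le> c ^ m * cmod (it n z)" "cmod (it (m + n) z) < r"
    by auto
qed

lemma basin_tendsto_0:
  assumes "z \<in> basin" shows "(\<lambda>n. it n z) \<longlonglongrightarrow> 0"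
proof -
  obtain n where n: "cmod (it n z) < r"
    using assms by (auto simp: basin_def)
  have "(\<lambda>m. c ^ m * cmod (it n z)) \<longlonglongrightarrow> 0 * cmod (it n z)"
    using c by (intro tendsto_intros LIMSEQ_power_zero) auto
  then have "(\<lambda>m. c ^ m * cmod (it n z)) \<longlonglongrightarrow> 0"
    by simp
  then have "(\<lambda>m. it (m + n) z) \<longlonglongrightarrow> 0"
    by (rule Lim_null_comparison[rotated]) (use it_contract(1)[OF n] in simp)
  then show ?thesis
    by (rule LIMSEQ_offset)
qed

lemma open_basin: "open basin"
proof -
  have "basin = (\<Union>n. it n -` ball 0 r)"
    by (auto simp: basin_def)
  moreover have "open (it n -` ball 0 r)" for n
    by (intro open_vimage continuous_on_poly_pow open_ball)
  ultimately show ?thesis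
    by auto
qed

text \<open>An orbit beyond \<open>R\<close> stays beyond \<open>R\<close>, so it could not tend to
  0.\<close>

lemma basin_bounded_iterates:
  assumes "z \<in> basin" shows "cmod (it n z) \<le> R"
proof (rule ccontr)
  assume "\<not> ?thesis"
  then have "R < cmod (it (m + n) z)" for m
    by (induction m) (auto intro: escape)
  moreover have "(\<lambda>m. cmod (it (m + n) z)) \<longlonglongrightarrow> 0"
    using basin_tendsto_0[OF assms] by (intro tendsto_norm_zero LIMSEQ_ignore_initial_segment)
  ultimately have "R \<le> 0"
    by (intro LIMSEQ_le_const) (auto intro: less_imp_le)
  then show False
    using R_pos by simp
qed

lemma basin_in_fatou_set: "Pt ` basin \<subseteq> F"
  using bounded_iterates_in_fatou_set open_basin R_pos basin_bounded_iterates by blast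

lemma zero_in_basin: "0 \<in> basin"
proof -
  have "cmod (it 0 0) < r"
    using r_pos by simp
  then show ?thesis
    unfolding basin_def by blast
qed

text \<open>On the Fatou set equicontinuity makes convergence of the orbit to 0 a closed condition,
  so the basin is relatively clopen in it.\<close>

lemma open_fatou_set_minus_basin: "open (F - Pt ` basin)"
  unfolding open_dist
proof
  fix x assume x: "x \<in> F - Pt ` basin"
  have "open (Pt ` ball 0 r)" "Pt 0 \<in> Pt ` ball 0 r"
    using r_pos by (auto intro!: open_Pt_image)
  then obtain e where e: "e > 0" "\<And>y. dist y (Pt 0) < e \<Longrightarrow> y \<in> Pt ` ball 0 r"
    unfolding open_dist by blast
  have "e/2 > 0"
    using e by simp
  then obtain d1 where d1: "d1 > 0"
    "\<And>n y. y \<in> F \<Longrightarrow> dist y x < d1 \<Longrightarrow> dist ((sphere_poly G ^^ n) y) ((sphere_poly G ^^ n) x) < e/2"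
    using fatou_set_maximal(2)[of "sphere_poly G"] x unfolding equicontinuous_on_def by blast
  obtain d2 where d2: "d2 > 0" "\<And>y. dist y x < d2 \<Longrightarrow> y \<in> F"
    using fatou_set_maximal(1)[of "sphere_poly G"] x unfolding open_dist by blast
  have "y \<notin> Pt ` basin" if y: "dist y x < min d1 d2" for y
  proof
    assume "y \<in> Pt ` basin"
    then obtain w where w: "y = Pt w" "w \<in> basin"
      by blast
    \<comment> \<open>The chordal distance is at most twice the Euclidean one, so \<open>e/4\<close>
      yields the required \<open>e/2\<close>.\<close>
    have "\<forall>\<^sub>F n in sequentially. dist (it n w) 0 < e/4"
      using basin_tendsto_0[OF w(2)] e(1) by (intro tendstoD) auto
    then obtain n where n: "cmod (it n w) < e/4"
      by (auto simp: eventually_sequentially)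
    have "dist ((sphere_poly G ^^ n) y) (Pt 0) < e/2"
      using dist_Pt_le[of "it n w" 0] n by (simp add: w sphere_poly_pow_Pt)
    moreover have "dist ((sphere_poly G ^^ n) y) ((sphere_poly G ^^ n) x) < e/2"
      using d1 d2 y by simp
    ultimately have "dist ((sphere_poly G ^^ n) x) (Pt 0) < e"
      by (metis dist_triangle_half_r)
    then have n': "(sphere_poly G ^^ n) x \<in> Pt ` ball 0 r"
      by (rule e)
    \<comment> \<open>At time \<open>n\<close> the orbit of \<open>x\<close> is in the disk. A
      finite \<open>x\<close> would then lie in the basin, and \<open>Infty\<close> is fixed, so it
      never enters.\<close>
    show False
    proof (cases x)
      case (Pt z)
      then show ?thesis
        using n' x basin_in_fatou_set by (fastforce simp: sphere_poly_pow_Pt basin_def)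
    next
      case Infty
      have "(sphere_poly G ^^ n) Infty = Infty"
        by (induction n) (use nonconst in auto)
      then show ?thesis
        using n' Infty by auto
    qed
  qed
  then show "\<exists>e>0. \<forall>y. dist y x < e \<longrightarrow> y \<in> F - Pt ` basin"
    using d1(1) d2 by (intro exI[of _ "min d1 d2"]) auto
qed

text \<open>The basin and the rest of the Fatou set are both open, so the connected component,
  meeting the basin at 0, cannot meet the rest.\<close>

lemma component_subset_basin: "origin_fatou_component G \<subseteq> Pt ` basin"
proof (rule ccontr)
  let ?C = "origin_fatou_component G"
  assume *: "\<not> ?C \<subseteq> Pt ` basin"
  have C: "connected ?C" "?C \<subseteq> F" "Pt 0 \<in> ?C"
    using basin_in_fatou_set zero_in_basin
    by (auto simp: origin_fatou_component_def connected_component_in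
        intro!: connected_component_refl dest: connected_component_in)
  have "Pt ` basin \<inter> ?C = {} \<or> (F - Pt ` basin) \<inter> ?C = {}"
    by (rule connectedD[OF C(1) open_Pt_image[OF open_basin] open_fatou_set_minus_basin])
      (use C(2) in auto)
  then show False
    using C zero_in_basin * by auto
qed

section \<open>The component as a planar domain\<close>

text \<open>Basin points are finite, so the component misses \<open>Infty\<close> and nothing is
  lost by working in the plane.\<close>

lemma component_eq_image: "origin_fatou_component G = Pt ` K_p G"
  using component_subset_basin by (auto simp: K_p_def)

lemma K_p_subset_basin: "K_p G \<subseteq> basin"
  using component_subset_basin by (auto simp: K_p_def)

lemma zero_in_K_p: "0 \<in> K_p G"
  using basin_in_fatou_set zero_in_basin
  by (auto simp: K_p_def origin_fatou_component_def intro!: connected_component_refl)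

lemma connected_K_p: "connected (K_p G)"
proof -
  have "connected (Pt ` K_p G)"
    unfolding component_eq_image[symmetric] origin_fatou_component_def
    by (rule connected_connected_component)
  moreover have "continuous_on (Pt ` K_p G) unPt"
    using continuous_on_unPt by (rule continuous_on_subset) blast
  ultimately have "connected (unPt ` Pt ` K_p G)"
    by (rule connected_continuous_image[rotated])
  then show ?thesis
    by (simp add: image_image)
qed

text \<open>Maximality of the component, carried over to the plane; openness, relative closedness
  and filling all rest on it.\<close>

lemma connected_subset_K_p:
  assumes "connected U" "Pt ` U \<subseteq> F" "U \<inter> K_p G \<noteq> {}"
  shows "U \<subseteq> K_p G"
proof -
  obtain z where z: "z \<in> U" "Pt z \<in> connected_component_set F (Pt 0)"
    using assms(3) by (auto simp: K_p_def origin_fatou_component_def)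
  have "connected (Pt ` U)"
    using assms(1) continuous_on_Pt connected_continuous_image by blast
  then have "Pt ` U \<subseteq> connected_component_set F (Pt z)"
    using assms(2) z(1) by (intro connected_component_maximal) auto
  then show ?thesis
    using connected_component_eq[OF z(2)] by (auto simp: K_p_def origin_fatou_component_def)
qed

lemma open_K_p: "open (K_p G)"
  unfolding open_contains_ball
proof
  fix z assume z: "z \<in> K_p G"
  then obtain e where e: "e > 0" "ball z e \<subseteq> basin"
    using K_p_subset_basin open_basin open_contains_ball by blast
  have "ball z e \<inter> K_p G \<noteq> {}"
    using e(1) z centre_in_ball by blast
  then have "ball z e \<subseteq> K_p G"
    using basin_in_fatou_set e(2) by (intro connected_subset_K_p) auto
  then show "\<exists>e>0. ball z e \<subseteq> K_p G"
    using e(1) by blast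
qed

lemma bounded_K_p: "bounded (K_p G)"
proof -
  have "K_p G \<subseteq> cball 0 R"
    using basin_bounded_iterates[of _ 0] K_p_subset_basin by auto
  then show ?thesis
    using bounded_cball bounded_subset by blast
qed

text \<open>A basin disk around a limit point of the component meets it, hence is absorbed by it. So
  the component is relatively closed in the basin.\<close>

lemma closure_K_p_Int_basin: "closure (K_p G) \<inter> basin = K_p G"
proof -
  have "z \<in> K_p G" if z: "z \<in> closure (K_p G)" "z \<in> basin" for z
  proof -
    obtain e where e: "e > 0" "ball z e \<subseteq> basin"
      using z(2) open_basin open_contains_ball by blast
    have "ball z e \<inter> K_p G \<noteq> {}"
      using z(1) e(1) by (metis centre_in_ball disjoint_iff open_Int_closure_eq_empty open_ball)
    then have "ball z e \<subseteq> K_p G"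
      using e(2) basin_in_fatou_set by (intro connected_subset_K_p) auto
    then show ?thesis
      using e(1) by auto
  qed
  then show ?thesis
    using K_p_subset_basin closure_subset by blast
qed

text \<open>By the maximum principle the iterates stay bounded on the inside of any loop in the component,
  so the inside belongs to the Fatou set, hence to the component.\<close>

lemma inside_subset_K_p:
  assumes "compact P" "connected P" "P \<subseteq> K_p G" "P \<noteq> {}"
  shows "inside P \<subseteq> K_p G"
proof -
  have bound: "cmod (it n z) \<le> R" if "z \<in> inside P" for n z
  proof (rule maximum_modulus_frontier[of "it n" "inside P"])
    fix w assume "w \<in> frontier (inside P)"
    then have "w \<in> basin"
      using frontier_inside_subset[of P] assms(1,3) compact_imp_closed K_p_subset_basin by blast
    then show "cmod (it n w) \<le> R"
      by (rule basin_bounded_iterates)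
  qed (use that assms(1) in \<open>auto intro: holomorphic_on_poly_pow continuous_on_poly_pow
        bounded_inside compact_imp_bounded\<close>)
  have "Pt ` inside P \<subseteq> F"
    using open_inside[of P] assms(1) compact_imp_closed R_pos bound
    by (intro bounded_iterates_in_fatou_set[of _ R]) auto
  moreover have "Pt ` P \<subseteq> F"
    using assms(3) K_p_subset_basin basin_in_fatou_set by blast
  \<comment> \<open>The inside alone is not yet known to meet the component; \<open>P\<close> ties
    it to the component.\<close>
  moreover have "connected (P \<union> inside P)"
    using assms(1,2) by (intro connected_with_inside compact_imp_closed)
  ultimately have "P \<union> inside P \<subseteq> K_p G"
    using assms(3,4) by (intro connected_subset_K_p) auto
  then show ?thesis
    by blast
qed

text \<open>A point off the component is neither on a loop in it nor inside that loop, so it lies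
  outside and has winding number 0.\<close>

lemma simply_connected_K_p: "simply_connected (K_p G)"
proof -
  have "winding_number \<gamma> z = 0"
    if \<gamma>: "path \<gamma>" "path_image \<gamma> \<subseteq> K_p G" "pathfinish \<gamma> = pathstart \<gamma>" and z: "z \<notin> K_p G" for \<gamma> z
  proof -
    have "inside (path_image \<gamma>) \<subseteq> K_p G"
      using \<gamma> by (intro inside_subset_K_p) (auto simp: compact_path_image connected_path_image)
    then have "z \<in> outside (path_image \<gamma>)"
      using z \<gamma>(2) by (auto simp: outside_inside)
    then show ?thesis
      using \<gamma> winding_number_zero_in_outside by blast
  qed
  then show ?thesis
    using open_K_p connected_K_p simply_connected_eq_winding_number_zero by blast
qed

end

section \<open>Extension of the local inverse to the basin, and its barrier\<close>

text \<open>\<open>Q_lower\<close> is quantitative: a small value of \<open>Q\<close> forces the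
  point to be close to 0.\<close>

locale koenigs = attracting_origin +
  fixes a :: complex and Q :: "complex \<Rightarrow> complex"
  assumes a: "0 < cmod a" "cmod a < 1"
    and Q_holo: "Q holomorphic_on ball 0 r"
    and Q_lower: "\<And>z. cmod z < r \<Longrightarrow> cmod z \<le> 2 * cmod (Q z)"
    and Q_eq: "\<And>z. cmod z < r \<Longrightarrow> Q (poly G z) = a * Q z"
begin

text \<open>The conserved quantity, evaluated at the first entry into the disk. By
  \<open>Qext_eq\<close> any later time would do as well.\<close>

definition Qext :: "complex \<Rightarrow> complex" where
  "Qext z = (let n = LEAST n. cmod (it n z) < r in Q (it n z) / a ^ n)"

lemma Q_it:
  assumes "cmod (it n z) < r"
  shows "Q (it (m + n) z) = a ^ m * Q (it n z)"
proof (induction m)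
  case (Suc m)
  then show ?case
    using Q_eq it_contract(2)[OF assms, of m] by simp
qed simp

lemma Qext_eq:
  assumes "cmod (it n z) < r"
  shows "Qext z = Q (it n z) / a ^ n"
proof -
  define k where "k = (LEAST n. cmod (it n z) < r)"
  have k: "cmod (it k z) < r" "k \<le> n"
    using assms unfolding k_def by (auto intro: LeastI Least_le)
  have "Q (it n z) = a ^ (n - k) * Q (it k z)"
    using Q_it[OF k(1), of "n - k"] k(2) by simp
  moreover have "a ^ n = a ^ (n - k) * a ^ k"
    using k(2) by (simp flip: power_add)
  ultimately show ?thesis
    using a by (simp add: Qext_def Let_def flip: k_def)
qed

text \<open>First entry times may jump, but one fixed \<open>n\<close> serves a whole neighborhood,
  and there the extension is \<open>Q (it n w) / a ^ n\<close>.\<close>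

lemma Qext_analytic: "Qext analytic_on basin"
  unfolding analytic_on_def
proof
  fix z assume "z \<in> basin"
  then obtain n where n: "cmod (it n z) < r"
    by (auto simp: basin_def)
  have "open (it n -` ball 0 r)"
    by (intro open_vimage continuous_on_poly_pow open_ball)
  then obtain e where e: "e > 0" "ball z e \<subseteq> it n -` ball 0 r"
    using n open_contains_ball by (metis mem_ball_0 vimageI2)
  have "(Q \<circ> it n) holomorphic_on ball z e"
    using Q_holo e(2) holomorphic_on_poly_pow by (intro holomorphic_on_compose_gen) auto
  then have "(\<lambda>w. Q (it n w) / a ^ n) holomorphic_on ball z e"
    using a by (auto simp: o_def intro!: holomorphic_intros)
  moreover have "Qext w = Q (it n w) / a ^ n" if "w \<in> ball z e" for w
    using that e(2) by (intro Qext_eq) auto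
  ultimately show "\<exists>e>0. Qext holomorphic_on ball z e"
    using e(1) holomorphic_cong by (metis (no_types, lifting))
qed

lemma Qext_unbounded_near_frontier:
  assumes z0: "z0 \<in> frontier (K_p G)" and "e > 0"
    and M: "\<And>z. z \<in> K_p G \<inter> ball z0 e \<Longrightarrow> cmod (Qext z) \<le> M"
  shows False
proof -
  let ?B = "ball z0 e"
  have z0': "z0 \<in> closure (K_p G)" "z0 \<notin> K_p G"
    using z0 open_K_p by (auto simp: frontier_def interior_open)
  obtain w where w: "w \<in> K_p G" "w \<in> ?B"
    using z0'(1) \<open>e > 0\<close> by (metis closure_approachable dist_commute mem_ball)
  \<comment> \<open>Take \<open>n\<close> so large that \<open>w\<close> has entered the disk and
    every component point of \<open>?B\<close> that is in the disk at time \<open>n\<close> is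
    within \<open>r/2\<close> of 0.\<close>
  have "(\<lambda>n. 2 * (M * cmod a ^ n)) \<longlonglongrightarrow> 2 * (M * 0)"
    using a by (intro tendsto_intros LIMSEQ_power_zero) auto
  then have "\<forall>\<^sub>F n in sequentially. 2 * (M * cmod a ^ n) < r/2"
    by (rule order_tendstoD) (use r_pos in simp)
  moreover have "\<forall>\<^sub>F n in sequentially. dist (it n w) 0 < r"
    using w(1) K_p_subset_basin r_pos by (intro tendstoD basin_tendsto_0) auto
  ultimately have "\<forall>\<^sub>F n in sequentially. 2 * (M * cmod a ^ n) < r/2 \<and> dist (it n w) 0 < r"
    by (rule eventually_conj)
  then obtain n where n: "2 * (M * cmod a ^ n) < r/2" "cmod (it n w) < r"
    by (auto simp: eventually_sequentially)
  define E where "E = K_p G \<inter> ?B \<inter> it n -` ball 0 r"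
  have half: "cmod (it n z) \<le> r/2" if "z \<in> E" for z
  proof -
    have z: "cmod (it n z) < r" "z \<in> K_p G \<inter> ?B"
      using that by (auto simp: E_def)
    have "cmod (it n z) \<le> 2 * cmod (Q (it n z))"
      by (rule Q_lower[OF z(1)])
    also have "Q (it n z) = Qext z * a ^ n"
      using Qext_eq[OF z(1)] a by simp
    also have "2 * cmod (Qext z * a ^ n) \<le> 2 * (M * cmod a ^ n)"
      using M[OF z(2)] by (simp add: norm_mult norm_power mult_right_mono)
    finally show ?thesis
      using n by simp
  qed
  \<comment> \<open>The gap between \<open>r/2\<close> and \<open>r\<close> makes the entry
    condition survive limits; a limit is then in the basin, hence in the component.\<close>
  have "?B \<inter> closure E \<subseteq> E"
  proof
    fix z assume z: "z \<in> ?B \<inter> closure E"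
    have "closed (it n -` cball 0 (r/2))"
      by (intro closed_vimage continuous_on_poly_pow closed_cball)
    moreover have "E \<subseteq> it n -` cball 0 (r/2)"
      using half by auto
    ultimately have "closure E \<subseteq> it n -` cball 0 (r/2)"
      by (rule closure_minimal[rotated])
    then have "cmod (it n z) \<le> r/2"
      using z by auto
    then have *: "cmod (it n z) < r"
      using r_pos by simp
    moreover have "closure E \<subseteq> closure (K_p G)"
      by (intro closure_mono) (auto simp: E_def)
    ultimately have "z \<in> closure (K_p G) \<inter> basin"
      using z by (auto simp: basin_def)
    then have "z \<in> K_p G"
      by (simp only: closure_K_p_Int_basin)
    then show "z \<in> E"
      using * z by (auto simp: E_def)
  qed
  moreover have "open E"
    unfolding E_def by (intro open_Int open_K_p open_ball open_vimage continuous_on_poly_pow)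
  moreover have "E \<inter> ?B \<noteq> {}"
    using w n by (auto simp: E_def)
  \<comment> \<open>\<open>E\<close> is open, nonempty and relatively closed in the connected disk,
    so it fills it, centre included.\<close>
  ultimately have "- closure E \<inter> ?B = {}"
    using connectedD[OF connected_ball, of E "- closure E" z0 e] closure_subset[of E] by blast
  then have "z0 \<in> E"
    using \<open>?B \<inter> closure E \<subseteq> E\<close> centre_in_ball[of z0 e] \<open>e > 0\<close> by blast
  then show False
    using z0'(2) by (auto simp: E_def)
qed

text \<open>An analytic continuation would be bounded on the compact disk of half the radius,
  against the unboundedness just shown.\<close>

lemma singularity_barrier_Qext: "singularity_barrier (K_p G) Qext"
  unfolding singularity_barrier_def
proof (intro ballI allI impI notI)
  fix z0 and s :: real
  assume z0: "z0 \<in> frontier (K_p G)" "s > 0"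
    and "\<exists>h. h analytic_on K_p G \<union> ball z0 s \<and> (\<forall>z\<in>K_p G. h z = Qext z)"
  then obtain h where h: "h analytic_on K_p G \<union> ball z0 s" "\<And>z. z \<in> K_p G \<Longrightarrow> h z = Qext z"
    by blast
  have "continuous_on (cball z0 (s/2)) h"
    using h(1) \<open>s > 0\<close>
    by (intro holomorphic_on_imp_continuous_on analytic_imp_holomorphic analytic_on_subset[OF h(1)]) auto
  then have "bounded (h ` cball z0 (s/2))"
    by (intro compact_imp_bounded compact_continuous_image compact_cball)
  then obtain M where "\<And>z. z \<in> cball z0 (s/2) \<Longrightarrow> cmod (h z) \<le> M"
    unfolding bounded_iff by blast
  then have "cmod (Qext z) \<le> M" if "z \<in> K_p G \<inter> ball z0 (s/2)" for z
    using that h(2)[of z] by (metis IntD1 IntD2 ball_subset_cball subsetD)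
  then show False
    using Qext_unbounded_near_frontier z0 by (meson half_gt_zero)
qed

end

section \<open>From the germs at 0 to the locale assumptions\<close>

text \<open>Put z = Q(w) in \<phi>(a z) = g(\<phi>(z)) and apply \<open>Q\<close>. As
  \<open>Q\<close> is continuous with \<open>Q 0 = 0\<close>, the substitution keeps all points near
  0.\<close>

lemma analytic_local_inverse_functional_equation:
  assumes "poincare_map g a \<phi>" "analytic_local_inverse \<phi> Q"
  shows "\<forall>\<^sub>F w in nhds 0. Q (g w) = a * Q w"
proof -
  have Q: "Q analytic_on {0}" "Q 0 = 0" "\<forall>\<^sub>F z in nhds 0. Q (\<phi> z) = z"
    "\<forall>\<^sub>F w in nhds 0. \<phi> (Q w) = w"
    using assms(2) by (auto simp: analytic_local_inverse_def)
  have Q0: "filterlim Q (nhds 0) (nhds 0)"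
    using analytic_at_imp_isCont[OF Q(1)] Q(2) by (metis isCont_def tendsto_at_iff_tendsto_nhds)
  then have "filterlim (\<lambda>w. a * Q w) (nhds 0) (nhds 0)"
    by (rule tendsto_mult_right_zero)
  then have "\<forall>\<^sub>F w in nhds 0. Q (\<phi> (a * Q w)) = a * Q w"
    using Q(3) by (rule eventually_compose_filterlim[rotated])
  moreover have "\<forall>\<^sub>F w in nhds 0. \<phi> (a * Q w) = g (\<phi> (Q w))"
    using assms(1) Q0 by (auto simp: poincare_map_def intro: eventually_compose_filterlim)
  ultimately show ?thesis
    using Q(4) by eventually_elim simp
qed

text \<open>Since \<phi>'(0) = 1 < 2, |\<phi>(z)| \<le> 2|z| near 0; substitute z = Q(w).\<close>

lemma analytic_local_inverse_lower_bound:
  assumes "poincare_map g a \<phi>" "analytic_local_inverse \<phi> Q"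
  shows "\<forall>\<^sub>F w in nhds 0. cmod w \<le> 2 * cmod (Q w)"
proof -
  have Q: "Q analytic_on {0}" "Q 0 = 0" "\<forall>\<^sub>F w in nhds 0. \<phi> (Q w) = w"
    using assms(2) by (auto simp: analytic_local_inverse_def)
  have \<phi>: "\<phi> analytic_on {0}" "\<phi> 0 = 0" "deriv \<phi> 0 = 1"
    using assms(1) by (auto simp: poincare_map_def)
  have "(\<phi> has_field_derivative 1) (at 0)"
    using \<phi> by (metis DERIV_deriv_iff_field_differentiable analytic_on_imp_differentiable_at singletonI)
  then have "\<forall>\<^sub>F z in nhds 0. cmod (\<phi> z) \<le> 2 * cmod z"
    using \<phi>(2) by (intro eventually_norm_le_of_deriv) auto
  moreover have "filterlim Q (nhds 0) (nhds 0)"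
    using analytic_at_imp_isCont[OF Q(1)] Q(2) by (metis isCont_def tendsto_at_iff_tendsto_nhds)
  ultimately have "\<forall>\<^sub>F w in nhds 0. cmod (\<phi> (Q w)) \<le> 2 * cmod (Q w)"
    by (rule eventually_compose_filterlim)
  then show ?thesis
    using Q(3) by eventually_elim simp
qed

theorem theorem1p8:
  fixes G :: "complex poly" and a :: complex and \<phi> Q :: "complex \<Rightarrow> complex"
  assumes "degree G \<ge> 2"
    and "poly G 0 = 0"
    and "deriv (poly G) 0 = a"
    and "0 < cmod a" and "cmod a < 1"
    and "poincare_map (poly G) a \<phi>"
    and "analytic_local_inverse \<phi> Q"
  shows "origin_fatou_component G = Pt ` K_p G \<and> 0 \<in> K_p G \<and>
    open (K_p G) \<and> bounded (K_p G) \<and> simply_connected (K_p G) \<and>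
    (\<exists>Qe. Qe analytic_on K_p G \<and> (\<forall>\<^sub>F z in nhds 0. Qe z = Q z) \<and>
          singularity_barrier (K_p G) Qe)"
proof -
  obtain R where R: "R > 0" "\<And>z. R < cmod z \<Longrightarrow> R < cmod (poly G z)"
    using poly_escape_radius[OF assms(1,2)] by blast
  \<comment> \<open>The room between |a| and 1 turns the derivative at 0 into a contraction on a
    disk.\<close>
  obtain c where c: "cmod a < c" "c < 1"
    using assms(5) dense by blast
  have "(poly G has_field_derivative a) (at 0)"
    using assms(3) by (metis DERIV_deriv_iff_field_differentiable field_differentiable_def poly_DERIV)
  then have "\<forall>\<^sub>F z in nhds 0. cmod (poly G z) \<le> c * cmod z"
    using assms(2) c by (intro eventually_norm_le_of_deriv) auto
  moreover have "\<forall>\<^sub>F z in nhds 0. Q (poly G z) = a * Q z"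
    using assms(6,7) by (rule analytic_local_inverse_functional_equation)
  moreover have "\<forall>\<^sub>F z in nhds 0. cmod z \<le> 2 * cmod (Q z)"
    using assms(6,7) by (rule analytic_local_inverse_lower_bound)
  ultimately have "\<forall>\<^sub>F z in nhds 0. cmod (poly G z) \<le> c * cmod z \<and> Q (poly G z) = a * Q z \<and>
      cmod z \<le> 2 * cmod (Q z)"
    by eventually_elim simp
  then obtain r1 where r1: "r1 > 0" "\<And>z. cmod z < r1 \<Longrightarrow> cmod (poly G z) \<le> c * cmod z \<and>
      Q (poly G z) = a * Q z \<and> cmod z \<le> 2 * cmod (Q z)"
    unfolding eventually_nhds_metric by auto
  obtain r2 where r2: "r2 > 0" "Q holomorphic_on ball 0 r2"
    using assms(7) by (auto simp: analytic_local_inverse_def analytic_on_def)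
  \<comment> \<open>\<open>r1\<close> carries the three estimates, \<open>r2\<close> the analyticity
    of \<open>Q\<close>.\<close>
  interpret koenigs G R "min r1 r2" c a Q
  proof
    show "Q holomorphic_on ball 0 (min r1 r2)"
      using r2(2) by (rule holomorphic_on_subset) auto
  qed (use assms(1,4,5) R c r1 r2(1) in \<open>auto intro: order_trans[OF norm_ge_zero less_imp_le]\<close>)
  \<comment> \<open>Here time 0 is already an entry time, so no power of \<open>a\<close> is divided
    out.\<close>
  have "Qext z = Q z" if "z \<in> ball 0 (min r1 r2)" for z
    using Qext_eq[of 0 z] that by simp
  then have "\<forall>\<^sub>F z in nhds 0. Qext z = Q z"
    using eventually_nhds_in_open[of "ball 0 (min r1 r2)" 0] r_pos by (auto elim: eventually_mono)
  moreover have "Qext analytic_on K_p G"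
    using Qext_analytic K_p_subset_basin analytic_on_subset by blast
  ultimately show ?thesis
    using component_eq_image zero_in_K_p open_K_p bounded_K_p simply_connected_K_p
      singularity_barrier_Qext by blast
qed

end
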